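(* Let $G=(V,E)$ be a finite graph with root $r\in V$, nonnegative symmetric edge costs $c_{ij}=c_{ji}$, nonnegative vertex prizes $b_i$ and a parameter $\lambda>0$, in the unbounded-depth setting described in the context. Let $\{\psi_{ji}\}$ be a (non-reinforced) max-sum fixed point on $G$ whose total fields $\psi_j$ have a unique maximizer $(d_j^*,p_j^* )$ for every $j$, and let $S^*=(V^*,E^* )$ be the induced subgraph. Then for every subtree $S'=(V',E')$ of $G$ with $r\in V'$ and $V'\subseteq V^*$, we have $\mathcal{H}(S^* )\le \mathcal{H}(S')$.
   Context: Setting. $G=(V,E)$ is a finite undirected graph, $\partial i=\{j:(ij)\in E\}$, $r\in V$ a distinguished root, $c_{ij}=c_{ji}\ge 0$ for $(ij)\in E$, $b_i\ge 0$ for $i\in V$, $\lambda>0$, and we set $c_{i*}=\lambda b_i$. Each vertex $i\neq r$ carries variables $(p_i,d_i)$ with $p_i\in\partial i\cup\{*\}$ (the parent of $i$; $p_i=*$ means $i$ is not in the tree) and $d_i\in\{1,2,3,\dots\}$ (the depth, with no upper bound). The root's variables are fixed to a single value ($d_r=0$, $r$ always in the tree, contributing no cost). For adjacent $i,j$ let $f_{ij}(p_i,d_i,p_j,d_j)=1$ if ($p_i=j \Rightarrow d_i=d_j+1$ and $p_j\neq *$), and $0$ otherwise; let $g_{ij}=f_{ij}f_{ji}$. For a vertex $j$ write $c_{jp_j}$ for the edge cost $c_{j,p_j}$ if $p_j\in\partial j$ and for $\lambda b_j$ if $p_j=*$ (and $0$ for $j=r$). Max-sum fixed point: a family of functions $\psi_{ji}(d_j,p_j)$,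 one for each ordered pair $(j,i)$ with $(ij)\in E$, with values in $\mathbb{R}\cup\{-\infty\}$, such that, with $\phi_{kj}(d_j,p_j)=\max\{\psi_{kj}(d_k,p_k): g_{jk}(p_j,d_j,p_k,d_k)=1\}$, one has $\psi_{ji}(d_j,p_j)=-c_{jp_j}+\sum_{k\in\partial j\setminus\{i\}}\phi_{kj}(d_j,p_j)+C_{ji}$, where the constant $C_{ji}$ makes $\max_{d_j,p_j}\psi_{ji}=0$. The total field is $\psi_j(d_j,p_j)=-c_{jp_j}+\sum_{k\in\partial j}\phi_{kj}(d_j,p_j)+C_j$ with $C_j$ making its maximum $0$; $(d_j^*,p_j^* )=\arg\max\psi_j$. Induced subgraph: $V^*=\{i\in V: p_i^*\neq *\}\cup\{r\}$, $E^*=\{(i,p_i^* ): i\in V\setminus\{r\},\ p_i^*\in V\}$. Cost of a subgraph $S'=(V',E')$ with $r\in V'$: $\mathcal{H}(S')=\sum_{e\in E'}c_e+\lambda\sum_{i\in V\setminus V'}b_i$; in particular $\mathcal{H}(S^* )=\sum_{i\in V\setminus\{r\}}c_{ip_i^*}$. *)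

theory Defs
  imports "HOL-Library.Extended_Real"
begin

text \<open>
  A graph is a vertex set \<open>V\<close> together with a set \<open>E\<close> of two-element subsets of \<open>V\<close>.
  Edge costs are indexed by the edges themselves, so \<open>c\<^sub>i\<^sub>j\<close> is \<open>c {i, j}\<close> and
  the symmetry \<open>c\<^sub>i\<^sub>j = c\<^sub>j\<^sub>i\<close> is built in.
\<close>

definition finite_graph :: "'v set \<Rightarrow> 'v set set \<Rightarrow> bool" where
  "finite_graph V E \<longleftrightarrow> finite V \<and> (\<forall>e\<in>E. e \<subseteq> V \<and> card e = 2)"

definition nbrs :: "'v set set \<Rightarrow> 'v \<Rightarrow> 'v set" where
  "nbrs E i = {j. {i, j} \<in> E}"

definition connected_graph :: "'v set \<Rightarrow> 'v set set \<Rightarrow> bool" where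
  "connected_graph V E \<longleftrightarrow> (\<forall>u\<in>V. \<forall>v\<in>V. (u, v) \<in> {(x, y). {x, y} \<in> E}\<^sup>*)"

definition graph_cycle :: "'v set set \<Rightarrow> 'v list \<Rightarrow> bool" where
  "graph_cycle E xs \<longleftrightarrow> length xs \<ge> 3 \<and> distinct xs \<and>
     (\<forall>n < length xs. {xs ! n, xs ! (Suc n mod length xs)} \<in> E)"

definition subtree :: "'v set \<Rightarrow> 'v set set \<Rightarrow> 'v set \<Rightarrow> 'v set set \<Rightarrow> bool" where
  "subtree V E V' E' \<longleftrightarrow> V' \<subseteq> V \<and> E' \<subseteq> E \<and> (\<forall>e\<in>E'. e \<subseteq> V') \<and>
     connected_graph V' E' \<and> \<not> (\<exists>xs. graph_cycle E' xs)"

text \<open>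
  A state of a vertex is a pair (depth, parent), where the parent \<open>None\<close> is the value \<open>*\<close>.
  The single state of the root is encoded as \<open>(0, Some r)\<close>: its parent component is neither
  \<open>*\<close> nor a neighbour of \<open>r\<close>, as there are no loops.
\<close>

type_synonym 'v state = "nat \<times> 'v option"

definition states :: "'v set set \<Rightarrow> 'v \<Rightarrow> 'v \<Rightarrow> 'v state set" where
  "states E r i =
     (if i = r then {(0, Some r)} else {1..} \<times> insert None (Some ` nbrs E i))"

definition f_constr :: "'v \<Rightarrow> 'v \<Rightarrow> 'v state \<Rightarrow> 'v state \<Rightarrow> bool" where
  "f_constr i j xi xj \<longleftrightarrow>
     (snd xi = Some j \<longrightarrow> fst xi = fst xj + 1 \<and> snd xj \<noteq> None)"

definition g_constr :: "'v \<Rightarrow> 'v \<Rightarrow> 'v state \<Rightarrow> 'v state \<Rightarrow> bool" where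
  "g_constr i j xi xj \<longleftrightarrow> f_constr i j xi xj \<and> f_constr j i xj xi"

definition parent_cost ::
  "'v \<Rightarrow> ('v set \<Rightarrow> real) \<Rightarrow> ('v \<Rightarrow> real) \<Rightarrow> real \<Rightarrow> 'v \<Rightarrow> 'v state \<Rightarrow> real" where
  "parent_cost r c b lam j x =
     (if j = r then 0 else case snd x of None \<Rightarrow> lam * b j | Some k \<Rightarrow> c {j, k})"

text \<open>
  A family of messages \<open>psi\<close> assigns to an ordered pair \<open>(j, i)\<close> of adjacent vertices the
  function \<open>psi j i\<close> on the states of the sender \<open>j\<close>.
  The maximum in the definition of \<open>phi k j\<close> ranges over an infinite set, so it is written as
  a supremum, and attainment is imposed separately in \<open>max_sum_fixed_point\<close>.
  If no state of \<open>k\<close> is compatible with \<open>x\<close>, the supremum of the empty set gives \<open>-\<infinity>\<close>.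
\<close>

type_synonym 'v messages = "'v \<Rightarrow> 'v \<Rightarrow> 'v state \<Rightarrow> ereal"

definition compatible_values ::
  "'v set set \<Rightarrow> 'v \<Rightarrow> 'v messages \<Rightarrow> 'v \<Rightarrow> 'v \<Rightarrow> 'v state \<Rightarrow> ereal set" where
  "compatible_values E r psi k j x =
     {psi k j y | y. y \<in> states E r k \<and> g_constr j k x y}"

definition phi ::
  "'v set set \<Rightarrow> 'v \<Rightarrow> 'v messages \<Rightarrow> 'v \<Rightarrow> 'v \<Rightarrow> 'v state \<Rightarrow> ereal" where
  "phi E r psi k j x = Sup (compatible_values E r psi k j x)"

definition max_exists :: "ereal set \<Rightarrow> bool" where
  "max_exists A \<longleftrightarrow> A = {} \<or> Sup A \<in> A"

definition has_max_zero :: "'x set \<Rightarrow> ('x \<Rightarrow> ereal) \<Rightarrow> bool" where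
  "has_max_zero X h \<longleftrightarrow> (\<forall>x\<in>X. h x \<le> 0) \<and> (\<exists>x\<in>X. h x = 0)"

definition max_sum_fixed_point ::
  "'v set set \<Rightarrow> 'v \<Rightarrow> ('v set \<Rightarrow> real) \<Rightarrow> ('v \<Rightarrow> real) \<Rightarrow> real \<Rightarrow> 'v messages \<Rightarrow> bool" where
  "max_sum_fixed_point E r c b lam psi \<longleftrightarrow>
     (\<forall>j i. {i, j} \<in> E \<longrightarrow>
        (\<forall>x \<in> states E r j. psi j i x \<noteq> \<infinity>) \<and>
        (\<forall>x \<in> states E r i. max_exists (compatible_values E r psi j i x)) \<and>
        (\<exists>C::real. \<forall>x \<in> states E r j.
           psi j i x = - ereal (parent_cost r c b lam j x)
             + (\<Sum>k \<in> nbrs E j - {i}. phi E r psi k j x) + ereal C) \<and>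
        has_max_zero (states E r j) (psi j i))"

definition total_fields ::
  "'v set \<Rightarrow> 'v set set \<Rightarrow> 'v \<Rightarrow> ('v set \<Rightarrow> real) \<Rightarrow> ('v \<Rightarrow> real) \<Rightarrow> real \<Rightarrow>
   'v messages \<Rightarrow> ('v \<Rightarrow> 'v state \<Rightarrow> ereal) \<Rightarrow> bool" where
  "total_fields V E r c b lam psi Psi \<longleftrightarrow>
     (\<forall>j\<in>V.
        (\<exists>C::real. \<forall>x \<in> states E r j.
           Psi j x = - ereal (parent_cost r c b lam j x)
             + (\<Sum>k \<in> nbrs E j. phi E r psi k j x) + ereal C) \<and>
        has_max_zero (states E r j) (Psi j))"

text \<open>
  The depth of a vertex with parent \<open>*\<close> is a dummy: neither the constraints nor the costs
  depend on it, so every field is constant in \<open>d\<close> on the states \<open>(d, None)\<close>.  Uniqueness of the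
  maximizer is therefore understood up to the depth component of states with parent \<open>*\<close>;
  otherwise a vertex outside the induced subgraph could never have a unique maximizer.
  Uniqueness of the pair itself implies this condition.
\<close>

definition unique_maximizer :: "'v state set \<Rightarrow> ('v state \<Rightarrow> ereal) \<Rightarrow> 'v state \<Rightarrow> bool" where
  "unique_maximizer X h x \<longleftrightarrow> x \<in> X \<and> (\<forall>y\<in>X. h y \<le> h x) \<and>
     (\<forall>y\<in>X. h y = h x \<longrightarrow> y = x \<or> (snd y = None \<and> snd x = None))"

definition induced_vertices :: "'v set \<Rightarrow> 'v \<Rightarrow> ('v \<Rightarrow> 'v option) \<Rightarrow> 'v set" where
  "induced_vertices V r p = {i\<in>V. p i \<noteq> None} \<union> {r}"

definition induced_edges :: "'v set \<Rightarrow> 'v \<Rightarrow> ('v \<Rightarrow> 'v option) \<Rightarrow> 'v set set" where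
  "induced_edges V r p = {{i, j} | i j. i \<in> V - {r} \<and> p i = Some j \<and> j \<in> V}"

definition subgraph_cost ::
  "'v set \<Rightarrow> ('v set \<Rightarrow> real) \<Rightarrow> ('v \<Rightarrow> real) \<Rightarrow> real \<Rightarrow> 'v set \<Rightarrow> 'v set set \<Rightarrow> real" where
  "subgraph_cost V c b lam V' E' = (\<Sum>e\<in>E'. c e) + lam * (\<Sum>i \<in> V - V'. b i)"

end

(*
  At a fixed point the total fields are max-marginals, so uniqueness of the maximizers makes the
  maximizing states of neighbouring vertices compatible, and the message sent along an edge to the
  maximizing state is attained at the maximizing state of the sender.  Since depths are unbounded,
  a whole branch of the induced tree can follow a depth shift without loss, so for each message
  only changes of parents matter.

  Orient S' towards the root.  Passing from S* to S', a vertex i that changes its parent forces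
  some children in S* to change theirs: all of them if i leaves the tree, and the new parent of i
  if it is a child of i.  By induction from the leaves of S*, the cost change Q(i) accumulated along
  these forced changes bounds the loss of the message from i to its old parent, compared with its
  value at the maximizer, at some state of i with the new parent.  The depths of these states at
  different vertices need not fit together.  The optimality of the maximizer gives Q(i) >= 0, and
  the cost of S' minus the cost of S* is bounded below by the sum of Q over the vertices that are
  not forced by their parent.
*)

theory Submission
  imports Defs
begin

section \<open>Orienting a connected graph towards a root\<close>

text \<open>On \<open>V'\<close>, \<open>h\<close> is the distance to \<open>r\<close> and
  \<open>q i\<close> is the second vertex of a shortest path from \<open>i\<close> to
  \<open>r\<close>.\<close>

lemma connected_graph_parent_function:
  assumes "connected_graph V' E'" "\<And>e. e \<in> E' \<Longrightarrow> e \<subseteq> V'" "r \<in> V'"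
  obtains q :: "'v \<Rightarrow> 'v" and h :: "'v \<Rightarrow> nat"
  where "\<And>i. i \<in> V' - {r} \<Longrightarrow> q i \<in> V' \<and> {i, q i} \<in> E' \<and> h (q i) < h i"
proof -
  define R where "R = {(x, y). {x, y} \<in> E'}"
  define h where "h i = (LEAST n. (i, r) \<in> R ^^ n)" for i
  have "\<exists>j. j \<in> V' \<and> {i, j} \<in> E' \<and> h j < h i" if i: "i \<in> V' - {r}" for i
  proof -
    have "(i, r) \<in> R\<^sup>*"
      using assms(1,3) i by (auto simp: connected_graph_def R_def)
    then obtain n where "(i, r) \<in> R ^^ n"
      by (auto dest: rtrancl_imp_relpow)
    then have *: "(i, r) \<in> R ^^ h i"
      unfolding h_def by (rule LeastI)
    with i obtain m where m: "h i = Suc m"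
      by (cases "h i") auto
    with * obtain j where j: "(i, j) \<in> R" "(j, r) \<in> R ^^ m"
      by (auto dest: relpow_Suc_D2 simp del: relpow.simps)
    then have "h j \<le> m"
      unfolding h_def by (intro Least_le)
    with j m assms(2)[of "{i, j}"] show ?thesis
      by (auto simp: R_def)
  qed
  then show ?thesis
    using that by metis
qed

section \<open>Constraints and messages at states\<close>

text \<open>The depth of a state with parent \<open>None\<close> never enters a constraint. This
  compensates for maximizers being unique only up to such depths.\<close>

lemma g_constr_None_cong:
  "snd y = None \<Longrightarrow> snd y' = None \<Longrightarrow> g_constr i j x y \<longleftrightarrow> g_constr i j x y'"
  by (auto simp: g_constr_def f_constr_def)

lemma g_constr_commute: "g_constr i j x y \<longleftrightarrow> g_constr j i y x"
  by (auto simp: g_constr_def)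

lemma phi_None_cong:
  assumes "snd x = None" "snd x' = None"
  shows "phi E r psi k j x = phi E r psi k j x'"
proof -
  have "g_constr j k x y \<longleftrightarrow> g_constr j k x' y" for y
    using g_constr_None_cong[OF assms] g_constr_commute by metis
  then show ?thesis
    by (simp add: phi_def compatible_values_def)
qed

lemma phi_upper:
  assumes "y \<in> states E r k" "g_constr j k x y"
  shows "psi k j y \<le> phi E r psi k j x"
  unfolding phi_def compatible_values_def using assms by (intro Sup_upper) blast

section \<open>Fixed points with unique maximizers\<close>

locale max_sum_optimum =
  fixes V :: "'v set" and E :: "'v set set" and r :: 'v
    and c :: "'v set \<Rightarrow> real" and b :: "'v \<Rightarrow> real" and lam :: real
    and psi :: "'v messages" and Psi :: "'v \<Rightarrow> 'v state \<Rightarrow> ereal"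
    and dstar :: "'v \<Rightarrow> nat" and pstar :: "'v \<Rightarrow> 'v option"
  assumes graph: "finite_graph V E" and root: "r \<in> V"
    and fixed_point: "max_sum_fixed_point E r c b lam psi"
    and fields: "total_fields V E r c b lam psi Psi"
    and unique: "\<And>j. j \<in> V \<Longrightarrow> unique_maximizer (states E r j) (Psi j) (dstar j, pstar j)"
begin

abbreviation star :: "'v \<Rightarrow> 'v state" where
  "star j \<equiv> (dstar j, pstar j)"

abbreviation msg :: "'v \<Rightarrow> 'v \<Rightarrow> 'v state \<Rightarrow> ereal" where
  "msg \<equiv> phi E r psi"

abbreviation cost :: "'v \<Rightarrow> 'v state \<Rightarrow> real" where
  "cost \<equiv> parent_cost r c b lam"

lemma finite_V: "finite V"
  using graph by (simp add: finite_graph_def)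

lemma edgeD:
  assumes "{i, j} \<in> E"
  shows "i \<in> V" "j \<in> V" "i \<noteq> j"
proof -
  have "{i, j} \<subseteq> V" "card {i, j} = 2"
    using graph assms by (auto simp: finite_graph_def)
  then show "i \<in> V" "j \<in> V" "i \<noteq> j"
    by auto
qed

lemma nbrs_iff: "j \<in> nbrs E i \<longleftrightarrow> {i, j} \<in> E"
  by (simp add: nbrs_def)

lemma finite_nbrs: "finite (nbrs E i)"
  by (rule finite_subset[OF _ finite_V]) (auto simp: nbrs_iff dest: edgeD)

lemma star_states: "j \<in> V \<Longrightarrow> star j \<in> states E r j"
  using unique by (auto simp: unique_maximizer_def)

lemma star_root: "star r = (0, Some r)"
  using star_states[OF root] by (simp add: states_def)

lemma pstar_edge:
  assumes "i \<in> V - {r}" "pstar i = Some j"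
  shows "{i, j} \<in> E"
  using star_states[of i] assms by (auto simp: states_def nbrs_iff)

lemma pstar_root_neq: "{i, r} \<in> E \<Longrightarrow> pstar r \<noteq> Some i"
  using star_root edgeD by fastforce

lemma fixed_pointD:
  assumes "{j, i} \<in> E"
  shows "\<And>x. x \<in> states E r i \<Longrightarrow> max_exists (compatible_values E r psi j i x)"
    and "\<exists>C::real. \<forall>x \<in> states E r j.
      psi j i x = - ereal (cost j x) + (\<Sum>k \<in> nbrs E j - {i}. msg k j x) + ereal C"
    and "has_max_zero (states E r j) (psi j i)"
  using fixed_point assms unfolding max_sum_fixed_point_def by (simp_all add: insert_commute)

lemma psi_nonpos: "{i, j} \<in> E \<Longrightarrow> x \<in> states E r i \<Longrightarrow> psi i j x \<le> 0"
  using fixed_pointD(3) unfolding has_max_zero_def by blast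

lemma msg_nonpos:
  assumes "{i, j} \<in> E"
  shows "msg i j x \<le> 0"
  unfolding phi_def compatible_values_def
  using psi_nonpos[OF assms] by (auto intro!: Sup_least)

lemma psi_eq:
  assumes "{j, i} \<in> E"
  obtains C :: real where "\<And>x. x \<in> states E r j \<Longrightarrow>
    psi j i x = - ereal (cost j x) + (\<Sum>k \<in> nbrs E j - {i}. msg k j x) + ereal C"
  using fixed_pointD(2)[OF assms] by blast

lemma Psi_eq:
  assumes "j \<in> V"
  obtains C :: real where "\<And>x. x \<in> states E r j \<Longrightarrow>
    Psi j x = - ereal (cost j x) + (\<Sum>k \<in> nbrs E j. msg k j x) + ereal C"
  using fields assms unfolding total_fields_def by blast

lemma Psi_nonpos: "j \<in> V \<Longrightarrow> x \<in> states E r j \<Longrightarrow> Psi j x \<le> 0"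
  using fields unfolding total_fields_def has_max_zero_def by blast

lemma Psi_star: "j \<in> V \<Longrightarrow> Psi j (star j) = 0"
  using fields unique star_states unfolding total_fields_def has_max_zero_def unique_maximizer_def
  by (metis order_antisym)

lemma maximizer_cases:
  assumes "j \<in> V" "x \<in> states E r j" "Psi j x = 0"
  shows "x = star j \<or> snd x = None \<and> pstar j = None"
  using unique[OF assms(1)] assms Psi_star unfolding unique_maximizer_def by fastforce

section \<open>Max-marginals and compatibility of neighbouring maximizers\<close>

text \<open>The total field at its maximizer is 0, so the sum of the incoming messages is finite,
  and hence so is each summand.\<close>

lemma msg_star_finite:
  assumes "{k, j} \<in> E"
  shows "\<bar>msg k j (star j)\<bar> \<noteq> \<infinity>"
proof -
  have j: "j \<in> V"
    using edgeD assms by blast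
  obtain C :: real where "Psi j (star j) =
      - ereal (cost j (star j)) + (\<Sum>k \<in> nbrs E j. msg k j (star j)) + ereal C"
    using Psi_eq[OF j] star_states[OF j] by metis
  then have "\<bar>\<Sum>k \<in> nbrs E j. msg k j (star j)\<bar> \<noteq> \<infinity>"
    using Psi_star[OF j] by auto
  moreover have "k \<in> nbrs E j"
    using assms by (simp add: nbrs_iff insert_commute)
  ultimately show ?thesis
    using finite_nbrs by (auto simp: sum_Inf)
qed

text \<open>The message from \<open>j\<close> to \<open>i\<close> omits exactly the incoming message
  from \<open>i\<close>. Adding it back gives the total field up to normalization.\<close>

lemma psi_plus_msg:
  assumes "{j, i} \<in> E"
  obtains m :: real where
    "\<And>x. x \<in> states E r j \<Longrightarrow> psi j i x + msg i j x = Psi j x + ereal m"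
proof -
  have j: "j \<in> V" and i: "i \<in> nbrs E j"
    using edgeD assms by (auto simp: nbrs_iff)
  obtain C :: real where C: "\<And>x. x \<in> states E r j \<Longrightarrow>
      psi j i x = - ereal (cost j x) + (\<Sum>k \<in> nbrs E j - {i}. msg k j x) + ereal C"
    using psi_eq[OF assms] by blast
  obtain C' :: real where C': "\<And>x. x \<in> states E r j \<Longrightarrow>
      Psi j x = - ereal (cost j x) + (\<Sum>k \<in> nbrs E j. msg k j x) + ereal C'"
    using Psi_eq[OF j] by blast
  have "psi j i x + msg i j x = Psi j x + ereal (C - C')" if x: "x \<in> states E r j" for x
  proof -
    have "(\<Sum>k \<in> nbrs E j. msg k j x) = msg i j x + (\<Sum>k \<in> nbrs E j - {i}. msg k j x)"
      by (rule sum.remove[OF finite_nbrs i])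
    moreover have "ereal C = ereal C' + ereal (C - C')"
      by simp
    ultimately show ?thesis
      unfolding C[OF x] C'[OF x] by (simp only: ac_simps)
  qed
  then show ?thesis
    using that by blast
qed

text \<open>Both \<open>mj\<close> and \<open>mi\<close> stand for the maximum of
  \<open>psi j i x + psi i j y\<close> over compatible pairs. Comparing them at the pair
  \<open>(star j, y)\<close>, with \<open>y\<close> attaining the message, gives one inequality;
  exchanging \<open>i\<close> and \<open>j\<close> gives the other.\<close>

lemma edge_maximum:
  assumes e: "{i, j} \<in> E"
    and mj: "\<And>x. x \<in> states E r j \<Longrightarrow> psi j i x + msg i j x = Psi j x + ereal mj"
    and mi: "\<And>x. x \<in> states E r i \<Longrightarrow> psi i j x + msg j i x = Psi i x + ereal mi"
  obtains y where "y \<in> states E r i" "g_constr j i (star j) y" "psi i j y = msg i j (star j)"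
    "ereal mj \<le> Psi i y + ereal mi" "mj \<le> mi"
proof -
  have V: "i \<in> V" "j \<in> V" and e': "{j, i} \<in> E"
    using edgeD[OF e] e by (auto simp: insert_commute)
  have "max_exists (compatible_values E r psi i j (star j))"
    using fixed_pointD(1)[OF e star_states[OF V(2)]] .
  \<comment> \<open>The supremum of the empty set is minus infinity, but this message is
    finite.\<close>
  moreover have "compatible_values E r psi i j (star j) \<noteq> {}"
    using msg_star_finite[OF e] by (auto simp: phi_def bot_ereal_def)
  ultimately have "msg i j (star j) \<in> compatible_values E r psi i j (star j)"
    by (auto simp: max_exists_def phi_def)
  then obtain y where y: "y \<in> states E r i" "g_constr j i (star j) y" "psi i j y = msg i j (star j)"
    by (auto simp: compatible_values_def)
  have "psi j i (star j) \<le> msg j i y"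
    using y star_states V by (intro phi_upper) (auto simp: g_constr_commute)
  then have "psi j i (star j) + msg i j (star j) \<le> psi i j y + msg j i y"
    unfolding y(3) by (simp add: add.commute add_mono)
  then have le: "ereal mj \<le> Psi i y + ereal mi"
    using mj[OF star_states] mi[OF y(1)] Psi_star V by simp
  also have "\<dots> \<le> 0 + ereal mi"
    using Psi_nonpos V y by (intro add_right_mono) auto
  finally show ?thesis
    using that y le by simp
qed

lemma psi_None_cong:
  assumes "{j, i} \<in> E" "x \<in> states E r j" "x' \<in> states E r j" "snd x = None" "snd x' = None"
  shows "psi j i x = psi j i x'"
proof -
  obtain C :: real where C: "\<And>x. x \<in> states E r j \<Longrightarrow>
      psi j i x = - ereal (cost j x) + (\<Sum>k \<in> nbrs E j - {i}. msg k j x) + ereal C"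
    using psi_eq[OF assms(1)] by blast
  have "msg k j x = msg k j x'" for k
    using phi_None_cong[OF assms(4,5)] .
  then show ?thesis
    using assms by (simp add: C parent_cost_def)
qed

text \<open>Since \<open>mi = mj\<close>, the state \<open>y\<close> attaining the message has total
  field 0. By uniqueness it is \<open>star i\<close>, up to the dummy depth of a state with parent
  \<open>None\<close>.\<close>

lemma star_edge:
  assumes e: "{i, j} \<in> E"
  shows "g_constr j i (star j) (star i)" "msg i j (star j) = psi i j (star i)"
proof -
  have V: "i \<in> V" "j \<in> V" and e': "{j, i} \<in> E"
    using edgeD[OF e] e by (auto simp: insert_commute)
  obtain mj :: real where mj:
    "\<And>x. x \<in> states E r j \<Longrightarrow> psi j i x + msg i j x = Psi j x + ereal mj"
    using psi_plus_msg[OF e'] by blast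
  obtain mi :: real where mi:
    "\<And>x. x \<in> states E r i \<Longrightarrow> psi i j x + msg j i x = Psi i x + ereal mi"
    using psi_plus_msg[OF e] by blast
  have "mi \<le> mj"
    using edge_maximum[OF e' mi mj] by metis
  moreover obtain y where y: "y \<in> states E r i" "g_constr j i (star j) y"
    "psi i j y = msg i j (star j)" "ereal mj \<le> Psi i y + ereal mi" "mj \<le> mi"
    using edge_maximum[OF e mj mi] by metis
  ultimately have "0 \<le> Psi i y"
    by (cases "Psi i y") auto
  with Psi_nonpos V y have "Psi i y = 0"
    by (simp add: order_antisym)
  then have cases: "y = star i \<or> snd y = None \<and> pstar i = None"
    using maximizer_cases V y by blast
  show "g_constr j i (star j) (star i)"
    using cases y g_constr_None_cong[of y "star i"] by auto
  show "msg i j (star j) = psi i j (star i)"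
    using cases y psi_None_cong[OF e y(1) star_states] V by auto
qed

section \<open>Depths in the induced tree and losses of messages\<close>

lemma pstar_depth:
  assumes "i \<in> V - {r}" "pstar i = Some j"
  shows "dstar i = dstar j + 1" "pstar j \<noteq> None" "pstar j \<noteq> Some i"
  using star_edge(1)[OF pstar_edge[OF assms]] assms
  by (auto simp: g_constr_def f_constr_def)

text \<open>Depth counted up from the deepest vertices, so that induction on it proceeds from
  children to parents.\<close>

definition height :: "'v \<Rightarrow> nat" where
  "height i = Max (dstar ` V) - dstar i"

lemma height_less:
  assumes "i \<in> V - {r}" "pstar i = Some j"
  shows "height i < height j"
proof -
  have "dstar i \<le> Max (dstar ` V)"
    using assms finite_V by auto
  then show ?thesis
    using pstar_depth(1)[OF assms] by (simp add: height_def)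
qed

text \<open>The maximizer at \<open>k\<close> remains compatible when \<open>i\<close> moves, unless a parent relation
  between \<open>i\<close> and \<open>k\<close> is involved.\<close>

lemma msg_ge_star_nonadjacent:
  assumes "{k, i} \<in> E" "snd x \<noteq> Some k" "pstar k \<noteq> Some i"
  shows "msg k i (star i) \<le> msg k i x"
  unfolding star_edge(2)[OF assms(1)]
  using assms edgeD star_states by (intro phi_upper) (auto simp: g_constr_def f_constr_def)

text \<open>As depths are unbounded, the whole subtree hanging below \<open>k\<close> can follow a change of depth
  of \<open>i\<close>: child states are shifted, recursively down to the leaves.\<close>

lemma msg_ge_star:
  assumes "{k, i} \<in> E" "snd x \<noteq> Some k" "snd x \<noteq> None"
  shows "msg k i (star i) \<le> msg k i x"
  using assms
proof (induction "height k" arbitrary: k i x rule: less_induct)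
  case less
  note e = less.prems(1)
  have V: "i \<in> V" "k \<in> V"
    using edgeD[OF e] by auto
  show ?case
  proof (cases "pstar k = Some i")
    case False
    then show ?thesis
      using msg_ge_star_nonadjacent less.prems by blast
  next
    case True
    then have k: "k \<noteq> r"
      using pstar_root_neq e by (auto simp: insert_commute)
    \<comment> \<open>The state \<open>y\<close> keeps the parent of \<open>k\<close>, hence its
      cost, and only adapts the depth to that of \<open>x\<close>.\<close>
    define y where "y = (fst x + 1, Some i)"
    have y: "y \<in> states E r k"
      using k e by (auto simp: y_def states_def nbrs_iff)
    obtain C :: real where C: "\<And>x. x \<in> states E r k \<Longrightarrow>
        psi k i x = - ereal (cost k x) + (\<Sum>l \<in> nbrs E k - {i}. msg l k x) + ereal C"
      using psi_eq[OF e] by blast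
    have "msg l k (star k) \<le> msg l k y" if l: "l \<in> nbrs E k - {i}" for l
    proof -
      have el: "{l, k} \<in> E" and li: "snd y \<noteq> Some l" "snd y \<noteq> None"
        using l by (auto simp: nbrs_iff insert_commute y_def)
      show ?thesis
      proof (cases "pstar l = Some k")
        case True
        then have "l \<in> V - {r}"
          using pstar_root_neq[of k] el edgeD by (auto simp: insert_commute)
        then show ?thesis
          using less.hyps[OF height_less el li] True by blast
      next
        case False
        then show ?thesis
          using msg_ge_star_nonadjacent[OF el li(1)] by blast
      qed
    qed
    then have "(\<Sum>l \<in> nbrs E k - {i}. msg l k (star k)) \<le> (\<Sum>l \<in> nbrs E k - {i}. msg l k y)"
      by (rule sum_mono)
    moreover have "cost k y = cost k (star k)"
      using True by (simp add: y_def parent_cost_def)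
    ultimately have "psi k i (star k) \<le> psi k i y"
      using C[OF y] C[OF star_states] V by (auto intro!: add_mono)
    also have "\<dots> \<le> msg k i x"
      using y less.prems by (intro phi_upper) (auto simp: y_def g_constr_def f_constr_def)
    finally show ?thesis
      using star_edge(2)[OF e] by simp
  qed
qed

text \<open>Losses add up: \<open>s k\<close> bounds the loss of the message from \<open>k\<close>,
  and the change of the parent cost of \<open>i\<close> is added.\<close>

lemma psi_ge_star:
  assumes e: "{i, j} \<in> E" and x: "x \<in> states E r i"
    and s: "\<And>k. k \<in> nbrs E i - {j} \<Longrightarrow> msg k i (star i) - ereal (s k) \<le> msg k i x"
  shows "psi i j (star i) - ereal (cost i x - cost i (star i) + (\<Sum>k \<in> nbrs E i - {j}. s k))
    \<le> psi i j x"
proof -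
  obtain C :: real where C: "\<And>x. x \<in> states E r i \<Longrightarrow>
      psi i j x = - ereal (cost i x) + (\<Sum>k \<in> nbrs E i - {j}. msg k i x) + ereal C"
    using psi_eq[OF e] by blast
  \<comment> \<open>Real copies of the finite messages at the maximizer make the subtraction safe in
    \<open>ereal\<close>.\<close>
  define f where "f k = real_of_ereal (msg k i (star i))" for k
  have f: "msg k i (star i) = ereal (f k)" if "k \<in> nbrs E i - {j}" for k
    using msg_star_finite[of k i] that
    by (auto simp: f_def nbrs_iff insert_commute ereal_real)
  have "(\<Sum>k \<in> nbrs E i - {j}. ereal (f k - s k)) \<le> (\<Sum>k \<in> nbrs E i - {j}. msg k i x)"
    using s f by (intro sum_mono) fastforce
  then have "ereal ((\<Sum>k \<in> nbrs E i - {j}. f k) - (\<Sum>k \<in> nbrs E i - {j}. s k))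
      \<le> (\<Sum>k \<in> nbrs E i - {j}. msg k i x)"
    by (simp add: sum_subtractf)
  then have "- ereal (cost i x)
        + ereal ((\<Sum>k \<in> nbrs E i - {j}. f k) - (\<Sum>k \<in> nbrs E i - {j}. s k)) + ereal C
      \<le> psi i j x"
    unfolding C[OF x] by (intro add_mono) auto
  moreover have "psi i j (star i)
      = ereal (- cost i (star i) + (\<Sum>k \<in> nbrs E i - {j}. f k) + C)"
    using C[OF star_states] edgeD[OF e] f by simp
  ultimately show ?thesis
    by (simp add: algebra_simps)
qed

text \<open>Neither \<open>x\<close> nor \<open>star j\<close> makes one of \<open>i\<close>,
  \<open>j\<close> the parent of the other, so \<open>x\<close> competes in the maximum that
  \<open>star i\<close> attains.\<close>

lemma psi_star_upper:
  assumes i: "i \<in> V - {r}" and j: "pstar i = Some j"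
    and x: "x \<in> states E r i" "snd x \<noteq> Some j"
  shows "psi i j x \<le> psi i j (star i)"
proof -
  have "psi i j x \<le> msg i j (star j)"
    using x pstar_depth[OF i j] by (intro phi_upper) (auto simp: g_constr_def f_constr_def)
  then show ?thesis
    using star_edge(2)[OF pstar_edge[OF i j]] by simp
qed

lemma psi_star_finite:
  assumes "{i, j} \<in> E"
  shows "\<bar>psi i j (star i)\<bar> \<noteq> \<infinity>"
  using msg_star_finite star_edge assms by metis

section \<open>Forced changes of parents\<close>

text \<open>In the following \<open>X\<close> is an alternative parent assignment on the induced subgraph.  A vertex
  that gives up its parent forces those of its children in \<open>dependents\<close> to change parent too, and
  \<open>Q\<close> accumulates the cost differences along these forced changes.\<close>

definition tree :: "'v set" where
  "tree = {i \<in> V - {r}. pstar i \<noteq> None}"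

definition dependents :: "('v \<Rightarrow> 'v option) \<Rightarrow> 'v \<Rightarrow> 'v set" where
  "dependents X i = {k \<in> tree. pstar k = Some i \<and> (X i = None \<or> X i = Some k)}"

text \<open>The depth component \<open>0\<close> below is a dummy, since costs depend on parents only.\<close>

definition cost_change :: "('v \<Rightarrow> 'v option) \<Rightarrow> 'v \<Rightarrow> real" where
  "cost_change X i = cost i (0, X i) - cost i (star i)"

lemma finite_tree: "finite tree"
  using finite_V by (simp add: tree_def)

text \<open>The recursion is well-founded because dependents are children in the induced tree and so
  have smaller \<open>height\<close>.\<close>

lemma accumulated_change_exists:
  obtains Q :: "'v \<Rightarrow> real" where "\<And>i. Q i = cost_change X i + (\<Sum>k \<in> dependents X i. Q k)"
proof -
  define R where "R = measure height"
  define H where "H Q i = cost_change X i + (\<Sum>k \<in> dependents X i. Q k)"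
    for Q :: "'v \<Rightarrow> real" and i
  have R: "(k, i) \<in> R" if "k \<in> dependents X i" for i k
    using that height_less by (simp add: R_def dependents_def tree_def)
  have "wfrec R H i = cost_change X i + (\<Sum>k \<in> dependents X i. wfrec R H k)" for i
  proof -
    have "wfrec R H i = H (cut (wfrec R H) R i) i"
      by (rule wfrec) (simp add: R_def)
    then show ?thesis
      using R by (simp add: H_def cut_apply)
  qed
  then show ?thesis
    using that by blast
qed

text \<open>The conditions on \<open>X\<close> are local: new parents are neighbours inside the
  induced subgraph, no two vertices become each other's parent, and no vertex hangs from one that
  leaves the tree. No depth function common to all of \<open>X\<close> is assumed.\<close>

context
  fixes X :: "'v \<Rightarrow> 'v option" and Q :: "'v \<Rightarrow> real"
  assumes X_edge: "\<And>i k. i \<in> tree \<Longrightarrow> X i = Some k \<Longrightarrow> {i, k} \<in> E \<and> pstar k \<noteq> None"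
    and X_asym: "\<And>i k. i \<in> tree \<Longrightarrow> k \<in> tree \<Longrightarrow> X i = Some k \<Longrightarrow>
      X k \<noteq> None \<and> X k \<noteq> Some i"
    and X_closed: "\<And>i k. i \<in> tree \<Longrightarrow> k \<in> tree \<Longrightarrow> X i = None \<Longrightarrow> X k \<noteq> Some i"
    and Q: "\<And>i. Q i = cost_change X i + (\<Sum>k \<in> dependents X i. Q k)"
begin

text \<open>Dependents of \<open>i\<close> cannot keep \<open>i\<close> as parent under
  \<open>X\<close>, so the induction hypothesis supplies a state with the new parent for each of
  them. Only the new parent of \<open>i\<close> dictates the depth \<open>d\<close>; all other
  children follow it at no loss.\<close>

lemma accumulated_change_witness:
  assumes "i \<in> tree" "pstar i = Some j" "X i \<noteq> Some j"
  shows "\<exists>d \<ge> 1. psi i j (star i) - ereal (Q i) \<le> psi i j (d, X i)"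
  using assms
proof (induction "height i" arbitrary: i j rule: less_induct)
  case less
  note i = less.prems(1) and j = less.prems(2)
  have iV: "i \<in> V - {r}"
    using i by (simp add: tree_def)
  have e: "{i, j} \<in> E"
    using pstar_edge[OF iV j] .
  have child: "\<exists>d \<ge> 1. psi k i (star k) - ereal (Q k) \<le> psi k i (d, X k)"
    if k: "k \<in> dependents X i" for k
  proof -
    have kt: "k \<in> tree" and pk: "pstar k = Some i" and "X i = None \<or> X i = Some k"
      using k by (auto simp: dependents_def)
    then have "X k \<noteq> Some i"
      using X_asym[OF i kt] X_closed[OF i kt] by blast
    moreover have "height k < height i"
      using height_less kt pk by (simp add: tree_def)
    ultimately show ?thesis
      using less.hyps kt pk by blast
  qed
  have child_edge: "{k, i} \<in> E \<and> k \<in> V - {r}" if "k \<in> dependents X i" for k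
    using that pstar_edge by (auto simp: dependents_def tree_def)
  have childE: "k \<in> tree" if "{k, i} \<in> E" "pstar k = Some i" for k
    using that pstar_root_neq[of i] edgeD[of k i] by (auto simp: tree_def insert_commute)
  define s where "s k = (if k \<in> dependents X i then Q k else 0)" for k
  have "\<exists>d \<ge> 1. \<forall>k \<in> nbrs E i - {j}. msg k i (star i) - ereal (s k) \<le> msg k i (d, X i)"
  proof (cases "X i")
    case None
    \<comment> \<open>Without a parent the depth of \<open>i\<close> is a dummy, so 1 serves for all
      neighbours at once, whatever depths the witnesses of the children have.\<close>
    have "msg k i (star i) - ereal (s k) \<le> msg k i (1, X i)" if k: "k \<in> nbrs E i - {j}" for k
    proof (cases "pstar k = Some i")
      case False
      have "msg k i (star i) \<le> msg k i (1, X i)"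
        using k False None by (intro msg_ge_star_nonadjacent) (auto simp: nbrs_iff insert_commute)
      with False show ?thesis
        by (simp add: s_def dependents_def)
    next
      case True
      with k childE None have dep: "k \<in> dependents X i"
        by (auto simp: dependents_def nbrs_iff insert_commute)
      then obtain d where d: "d \<ge> 1" "psi k i (star k) - ereal (Q k) \<le> psi k i (d, X k)"
        using child by blast
      have kt: "k \<in> tree"
        using dep by (simp add: dependents_def)
      have "X k \<noteq> Some i"
        using X_closed[OF i kt None] .
      moreover have "(d, X k) \<in> states E r k"
        using X_edge[OF kt] kt d by (cases "X k") (auto simp: states_def tree_def nbrs_iff)
      ultimately have "psi k i (d, X k) \<le> msg k i (1, X i)"
        using None by (intro phi_upper) (auto simp: g_constr_def f_constr_def)
      with d dep show ?thesis
        using star_edge(2) child_edge by (auto simp: s_def)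
    qed
    then show ?thesis
      by (intro exI[of _ 1]) auto
  next
    case (Some l)
    have el: "{i, l} \<in> E" "{l, i} \<in> E" and pl: "pstar l \<noteq> None"
      using X_edge[OF i Some] by (auto simp: insert_commute)
    have "\<exists>d \<ge> 1. msg l i (star i) - ereal (s l) \<le> msg l i (d, X i)"
    proof (cases "pstar l = Some i")
      case False
      \<comment> \<open>If \<open>l\<close> is not a child of \<open>i\<close>, it keeps its
        maximizing state and \<open>i\<close> is placed one level below it.\<close>
      have "psi l i (star l) \<le> msg l i (dstar l + 1, X i)"
        using False Some pl el edgeD star_states
        by (intro phi_upper) (auto simp: g_constr_def f_constr_def)
      with False el show ?thesis
        using star_edge(2) by (intro exI[of _ "dstar l + 1"]) (auto simp: s_def dependents_def)
    next
      case True
      with el childE Some have dep: "l \<in> dependents X i"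
        by (auto simp: dependents_def)
      then obtain d where d: "d \<ge> 1" "psi l i (star l) - ereal (Q l) \<le> psi l i (d, X l)"
        using child by blast
      have lt: "l \<in> tree"
        using dep by (simp add: dependents_def)
      have Xl: "X l \<noteq> None" "X l \<noteq> Some i"
        using X_asym[OF i lt Some] by auto
      moreover have "(d, X l) \<in> states E r l"
        using X_edge[OF lt] lt d by (cases "X l") (auto simp: states_def tree_def nbrs_iff)
      ultimately have "psi l i (d, X l) \<le> msg l i (d + 1, X i)"
        using Some by (intro phi_upper) (auto simp: g_constr_def f_constr_def)
      with d dep show ?thesis
        using star_edge(2)[OF el(2)] by (intro exI[of _ "d + 1"]) (auto simp: s_def)
    qed
    then obtain d where d: "d \<ge> 1" "msg l i (star i) - ereal (s l) \<le> msg l i (d, X i)"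
      by blast
    have "msg k i (star i) - ereal (s k) \<le> msg k i (d, X i)" if k: "k \<in> nbrs E i - {j}" for k
    proof (cases "k = l")
      case False
      have "msg k i (star i) \<le> msg k i (d, X i)"
        using k False Some by (intro msg_ge_star) (auto simp: nbrs_iff insert_commute)
      with False Some show ?thesis
        by (simp add: s_def dependents_def)
    qed (use d in simp)
    with d show ?thesis
      by blast
  qed
  then obtain d where d: "d \<ge> 1"
    "\<And>k. k \<in> nbrs E i - {j} \<Longrightarrow> msg k i (star i) - ereal (s k) \<le> msg k i (d, X i)"
    by blast
  have st: "(d, X i) \<in> states E r i"
    using X_edge[OF i] iV d by (cases "X i") (auto simp: states_def nbrs_iff)
  \<comment> \<open>The old parent \<open>j\<close> is not a dependent, as its own parent is not
    \<open>i\<close>.\<close>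
  have "dependents X i \<subseteq> nbrs E i - {j}"
    using child_edge pstar_depth[OF iV j]
    by (auto simp: nbrs_iff insert_commute dependents_def)
  then have "(\<Sum>k \<in> nbrs E i - {j}. s k) = (\<Sum>k \<in> dependents X i. Q k)"
    using finite_nbrs by (intro sum.mono_neutral_cong_right) (auto simp: s_def)
  then have "Q i = cost i (d, X i) - cost i (star i) + (\<Sum>k \<in> nbrs E i - {j}. s k)"
    using Q[of i] by (simp add: cost_change_def parent_cost_def)
  with psi_ge_star[OF e st d(2)] d(1) show ?case
    by auto
qed

text \<open>If \<open>i\<close> keeps its parent, nothing is forced and \<open>Q i\<close> is 0.
  Otherwise a negative \<open>Q i\<close> would make the witness state beat \<open>star i\<close>,
  against \<open>psi_star_upper\<close>.\<close>

lemma accumulated_change_nonneg: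
  assumes i: "i \<in> tree"
  shows "0 \<le> Q i"
proof -
  obtain j where j: "pstar i = Some j" and iV: "i \<in> V - {r}"
    using i by (auto simp: tree_def)
  show ?thesis
  proof (cases "X i = Some j")
    case True
    then have "dependents X i = {}"
      using pstar_depth[OF iV j] by (auto simp: dependents_def)
    with True j Q[of i] show ?thesis
      by (simp add: cost_change_def parent_cost_def)
  next
    case False
    then obtain d where d: "d \<ge> 1" "psi i j (star i) - ereal (Q i) \<le> psi i j (d, X i)"
      using accumulated_change_witness i j by blast
    have "(d, X i) \<in> states E r i"
      using X_edge[OF i] iV d by (cases "X i") (auto simp: states_def nbrs_iff)
    then have "psi i j (d, X i) \<le> psi i j (star i)"
      using psi_star_upper[OF iV j] False by simp
    with d have "psi i j (star i) - ereal (Q i) \<le> psi i j (star i)"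
      by (meson order_trans)
    with psi_star_finite[OF pstar_edge[OF iV j]] show ?thesis
      by (cases "psi i j (star i)") auto
  qed
qed

text \<open>Each vertex is a dependent of at most one vertex, its old parent. Summing the recursion
  for \<open>Q\<close> over the tree thus leaves the sum of \<open>Q\<close> over the vertices not
  forced by their parent.\<close>

lemma sum_cost_change_nonneg: "0 \<le> (\<Sum>i \<in> tree. cost_change X i)"
proof -
  have "(\<Sum>i \<in> tree. \<Sum>k \<in> dependents X i. Q k) = (\<Sum>k \<in> (\<Union>i \<in> tree. dependents X i). Q k)"
    using finite_tree by (intro sum.UNION_disjoint[symmetric]) (auto simp: dependents_def)
  also have "\<dots> \<le> (\<Sum>k \<in> tree. Q k)"
    using finite_tree accumulated_change_nonneg
    by (intro sum_mono2) (auto simp: dependents_def)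
  moreover have "(\<Sum>i \<in> tree. Q i)
      = (\<Sum>i \<in> tree. cost_change X i) + (\<Sum>i \<in> tree. \<Sum>k \<in> dependents X i. Q k)"
    unfolding sum.distrib[symmetric] using Q by (rule sum.cong[OF refl])
  ultimately show ?thesis
    by simp
qed

end

end

section \<open>Comparison of the two costs\<close>

theorem theorem1:
  fixes V :: "'v set" and E :: "'v set set" and r :: 'v
    and c :: "'v set \<Rightarrow> real" and b :: "'v \<Rightarrow> real" and lam :: real
    and psi :: "'v messages" and Psi :: "'v \<Rightarrow> 'v state \<Rightarrow> ereal"
    and dstar :: "'v \<Rightarrow> nat" and pstar :: "'v \<Rightarrow> 'v option"
    and V' :: "'v set" and E' :: "'v set set"
  assumes "finite_graph V E" and "r \<in> V"
    and "\<And>e. e \<in> E \<Longrightarrow> 0 \<le> c e"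
    and "\<And>i. i \<in> V \<Longrightarrow> 0 \<le> b i"
    and "0 < lam"
    and "max_sum_fixed_point E r c b lam psi"
    and "total_fields V E r c b lam psi Psi"
    and "\<And>j. j \<in> V \<Longrightarrow> unique_maximizer (states E r j) (Psi j) (dstar j, pstar j)"
    and "subtree V E V' E'" and "r \<in> V'"
    and "V' \<subseteq> induced_vertices V r pstar"
  shows "subgraph_cost V c b lam (induced_vertices V r pstar) (induced_edges V r pstar)
           \<le> subgraph_cost V c b lam V' E'"
proof -
  interpret max_sum_optimum V E r c b lam psi Psi dstar pstar
    by unfold_locales fact+
  let ?W = "induced_vertices V r pstar"
  have sub: "V' \<subseteq> V" "E' \<subseteq> E" "\<And>e. e \<in> E' \<Longrightarrow> e \<subseteq> V'" "connected_graph V' E'"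
    using assms(9) by (auto simp: subtree_def)
  obtain q :: "'v \<Rightarrow> 'v" and h :: "'v \<Rightarrow> nat" where
    q: "\<And>i. i \<in> V' - {r} \<Longrightarrow> q i \<in> V' \<and> {i, q i} \<in> E' \<and> h (q i) < h i"
    using connected_graph_parent_function[OF sub(4,3) assms(10)] by metis
  define X where "X i = (if i \<in> V' then Some (q i) else None)" for i
  have tree_eq: "tree = ?W - {r}"
    by (auto simp: tree_def induced_vertices_def)
  have pstar_neq_None: "pstar k \<noteq> None" if "k \<in> V'" for k
    using that assms(11) star_root by (auto simp: induced_vertices_def)
  obtain Q :: "'v \<Rightarrow> real" where
    Q: "\<And>i. Q i = cost_change X i + (\<Sum>k \<in> dependents X i. Q k)"
    using accumulated_change_exists by metis
  have change: "0 \<le> (\<Sum>i \<in> tree. cost_change X i)"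
  proof (rule sum_cost_change_nonneg[OF _ _ _ Q])
    show "{i, k} \<in> E \<and> pstar k \<noteq> None" if "i \<in> tree" "X i = Some k" for i k
      using that q[of i] pstar_neq_None sub by (auto simp: X_def tree_eq split: if_splits)
    show "X k \<noteq> None \<and> X k \<noteq> Some i" if "i \<in> tree" "k \<in> tree" "X i = Some k" for i k
      \<comment> \<open>Since \<open>h\<close> strictly decreases along \<open>q\<close>, two
        vertices cannot be each other's parent.\<close>
      using that q[of i] q[of k] by (auto simp: X_def tree_eq split: if_splits)
    show "X k \<noteq> Some i" if "i \<in> tree" "k \<in> tree" "X i = None" for i k
      using that q[of k] by (auto simp: X_def tree_eq split: if_splits)
  qed
  have "finite ?W"
    using finite_V by (simp add: induced_vertices_def)
  have "finite E"
    using finite_V graph by (auto simp: finite_graph_def intro: finite_subset[of _ "Pow V"])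

  have "induced_edges V r pstar = (\<lambda>i. {i, the (pstar i)}) ` tree"
  proof (intro subset_antisym subsetI)
    fix e assume "e \<in> (\<lambda>i. {i, the (pstar i)}) ` tree"
    then obtain i j where "i \<in> V - {r}" "pstar i = Some j" "e = {i, j}"
      by (auto simp: tree_def)
    then show "e \<in> induced_edges V r pstar"
      using pstar_edge edgeD(2) unfolding induced_edges_def by blast
  qed (force simp: induced_edges_def tree_def)
  then have "sum c (induced_edges V r pstar) \<le> (\<Sum>i \<in> tree. c {i, the (pstar i)})"
    using finite_tree pstar_edge assms(3) sum_image_le[of tree c "\<lambda>i. {i, the (pstar i)}"]
    by (auto simp: tree_def)
  also have "\<dots> = (\<Sum>i \<in> tree. cost i (star i))"
    by (intro sum.cong) (auto simp: tree_def parent_cost_def)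
  also have "\<dots> \<le> (\<Sum>i \<in> tree. cost i (0, X i))"
    using change by (simp add: cost_change_def sum_subtractf)
  \<comment> \<open>Vertices of \<open>V'\<close> pay for an edge of \<open>E'\<close>; the others
    leave the tree and pay their prize.\<close>
  also have "tree = (V' - {r}) \<union> (?W - V')"
    using assms(10,11) by (auto simp: tree_eq)
  also have "(\<Sum>i \<in> \<dots>. cost i (0, X i)) =
      (\<Sum>i \<in> V' - {r}. cost i (0, X i)) + (\<Sum>i \<in> ?W - V'. cost i (0, X i))"
    using finite_V sub \<open>finite ?W\<close> by (intro sum.union_disjoint) (auto intro: finite_subset)
  also have "(\<Sum>i \<in> V' - {r}. cost i (0, X i)) = (\<Sum>i \<in> V' - {r}. c {i, q i})"
    by (intro sum.cong) (auto simp: X_def parent_cost_def)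
  also have "\<dots> = sum c ((\<lambda>i. {i, q i}) ` (V' - {r}))"
  proof (rule sum.reindex_cong[symmetric, OF _ refl refl])
    \<comment> \<open>An edge used by two vertices would make each the parent of the other, which
      \<open>h\<close> excludes.\<close>
    show "inj_on (\<lambda>i. {i, q i}) (V' - {r})"
    proof (rule inj_onI)
      fix i k assume "i \<in> V' - {r}" "k \<in> V' - {r}" "{i, q i} = {k, q k}"
      with q[of i] q[of k] show "i = k"
        by (auto simp: doubleton_eq_iff)
    qed
  qed
  also have "\<dots> \<le> sum c E'"
    using q sub assms(3) \<open>finite E\<close> by (intro sum_mono2) (auto intro: finite_subset)
  also have "(\<Sum>i \<in> ?W - V'. cost i (0, X i)) = lam * sum b (?W - V')"
    unfolding sum_distrib_left using assms(10) by (intro sum.cong) (auto simp: X_def parent_cost_def)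
  finally have "sum c (induced_edges V r pstar) \<le> sum c E' + lam * sum b (?W - V')"
    by simp
  \<comment> \<open>Prizes outside the induced subgraph occur in both costs and cancel.\<close>
  moreover have "sum b (V - V') = sum b (V - ?W) + sum b (?W - V')"
  proof -
    have "V - V' = (V - ?W) \<union> (?W - V')"
      using assms(11) root by (auto simp: induced_vertices_def)
    then show ?thesis
      using finite_V \<open>finite ?W\<close> by (auto intro: sum.union_disjoint)
  qed
  ultimately show ?thesis
    by (simp add: subgraph_cost_def distrib_left)
qed

end
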